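(* For every integer $n \geq 2$ and every positive divisor $s$ of $n$, $$ N_n^s = \frac{1}{n} \sum_{j|\frac{n}{s}} \mu (j) \, \varphi(sj) \, (sj)^{\frac{n}{sj}} \Big( \frac{n}{sj} \Big)! $$
   Context: $\mathscr{S}_n$ is the group of all permutations of $\{1,\ldots,n\}$, $\mathscr{C}_n \subset \mathscr{S}_n$ is the set of all $n$-cycles, and $\rho=(1\,2\,\cdots\,n)$, that is, $\rho(i)=i+1$ modulo $n$. The symmetry order $\operatorname{sym}(\nu)$ of $\nu\in\mathscr{C}_n$ is the order of the stabilizer group $\{\rho^j : \rho^j\nu\rho^{-j}=\nu\}$, a subgroup of the cyclic group generated by $\rho$ (which has order $n$). $N_n^s$ denotes the number of $\nu\in\mathscr{C}_n$ with $\operatorname{sym}(\nu)=s$. Here $\mu$ is the Möbius function, $\varphi$ is Euler's totient function, and the sum is over positive divisors $j$ of $n/s$. *)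

theory Defs
  imports
    Complex_Main
    "HOL-Combinatorics.Orbits"
    "HOL-Computational_Algebra.Squarefree"
    "HOL-Number_Theory.Totient"
begin

definition n_cycles :: "nat \<Rightarrow> (nat \<Rightarrow> nat) set" where
  "n_cycles n = {\<nu>. \<nu> permutes {1..n} \<and> cyclic_on \<nu> {1..n}}"

text \<open>
  The successor modulo \<open>n\<close> with representatives \<open>{1..n}\<close> instead of \<open>{0..<n}\<close>,
  extended by the identity so that \<open>rho n permutes {1..n}\<close>.
\<close>

definition rho :: "nat \<Rightarrow> nat \<Rightarrow> nat" where
  "rho n i = (if i \<in> {1..n} then i mod n + 1 else i)"

text \<open>
  Since \<open>rho n\<close> has finite order, its natural powers already form the cyclic group it generates.
  The stabilizer is a set of permutations, not of exponents.
\<close>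

definition rho_stabilizer :: "nat \<Rightarrow> (nat \<Rightarrow> nat) \<Rightarrow> (nat \<Rightarrow> nat) set" where
  "rho_stabilizer n \<nu> =
     {rho n ^^ j | j :: nat. (rho n ^^ j) \<circ> \<nu> \<circ> inv (rho n ^^ j) = \<nu>}"

definition sym_order :: "nat \<Rightarrow> (nat \<Rightarrow> nat) \<Rightarrow> nat" where
  "sym_order n \<nu> = card (rho_stabilizer n \<nu>)"

definition num_cycles_sym :: "nat \<Rightarrow> nat \<Rightarrow> nat" where
  "num_cycles_sym n s = card {\<nu> \<in> n_cycles n. sym_order n \<nu> = s}"

definition moebius_mu :: "nat \<Rightarrow> int" where
  "moebius_mu n = (if squarefree n then (-1) ^ card (prime_factors n) else 0)"

end

theory Submission
  imports Defs
begin

text \<open>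
Let \<open>F t\<close> be the number of \<open>n\<close>-cycles whose symmetry order is a multiple of the divisor \<open>t\<close> of
\<open>n\<close>. The wanted number is the sum of \<open>moebius_mu j * F (s * j)\<close> over the divisors \<open>j\<close> of
\<open>n div s\<close> (\<open>moebius_count\<close>), so everything rests on the formula
\<open>n * F t = totient t * t ^ d * fact d\<close> with \<open>d = n div t\<close>.

A cyclic group has only one subgroup of order \<open>t\<close>; therefore \<open>t\<close> divides the symmetry order of
\<open>\<nu>\<close> if and only if \<open>\<nu>\<close> commutes with \<open>rho n ^^ d\<close> (\<open>sym_order_dvd\<close>). To count these cycles,
mark a starting point \<open>x\<close>, which multiplies the number by \<open>n\<close>, and describe \<open>(\<nu>, x)\<close> by the
sequence \<open>x, \<nu> x, \<nu> (\<nu> x), \<dots>\<close>. A permutation that commutes with an \<open>n\<close>-cycle \<open>\<nu>\<close> is a power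
of \<open>\<nu>\<close>, and comparing orders shows that \<open>rho n ^^ d\<close> and \<open>\<nu> ^^ d\<close> generate the same group of
order \<open>t\<close>. So \<open>\<nu> ^^ d = rho n ^^ (d * v)\<close> with \<open>v\<close> a unit modulo \<open>t\<close>, and the whole sequence is
determined by \<open>v\<close> and its first \<open>d\<close> terms. These terms lie in the \<open>d\<close> different orbits of
\<open>rho n ^^ d\<close>, that is, in different residue classes modulo \<open>d\<close>
(\<open>commuting_cycle_is_spread\<close>). Conversely, every unit and every such list of \<open>d\<close> terms arise
(\<open>spread_numbering\<close>, \<open>spread_successor_commutes\<close>). There are \<open>totient t\<close> units, \<open>fact d\<close>
orders of the residue classes and \<open>t\<close> choices inside each of the \<open>d\<close> classes.
\<close>

section \<open>Cycles as numberings of their support\<close>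

text \<open>
Applied below to the periods of a point under a permutation and to the exponents \<open>j\<close> for which
\<open>rho n ^^ j\<close> commutes with a given function. The generator is the least positive element, since
remainders modulo it again satisfy \<open>P\<close>.
\<close>

lemma periods_are_multiples:
  fixes P :: "nat \<Rightarrow> bool"
  assumes "P p" "p > 0"
    and add: "\<And>a b. P a \<Longrightarrow> P b \<Longrightarrow> P (a + b)"
    and cancel: "\<And>a b. P (a + b) \<Longrightarrow> P a \<Longrightarrow> P b"
  obtains e where "e > 0" "\<And>j. P j \<longleftrightarrow> e dvd j"
proof -
  define e where "e = (LEAST e. e > 0 \<and> P e)"
  have e: "e > 0 \<and> P e"
    unfolding e_def by (rule LeastI[of _ p]) (use assms(1,2) in simp)
  have min: "e \<le> j" if "j > 0" "P j" for j
    unfolding e_def by (rule Least_le) (use that in simp)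
  have "P 0" using cancel[of p 0] assms(1) by simp
  then have mult: "P (e * k)" for k
    by (induction k) (simp_all add: add e)
  have "e dvd j" if "P j" for j
  proof -
    have "P (j mod e)"
      using that mult[of "j div e"] cancel[of "e * (j div e)" "j mod e"] by simp
    then show ?thesis
      using min[of "j mod e"] e by (metis dvd_eq_mod_eq_0 mod_less_divisor not_gr_zero not_le)
  qed
  then show thesis using that e mult by (metis dvdE)
qed

text \<open>
An \<open>n\<close>-cycle with a chosen starting point is the same thing as such a sequence, namely its
iterates at that point. Sequences are easier to count, because no function has to be inverted.
\<close>

definition cyclic_numbering :: "nat \<Rightarrow> (nat \<Rightarrow> nat) \<Rightarrow> bool" where
  "cyclic_numbering n g \<longleftrightarrow> range g = {1..n} \<and> (\<forall>i j. g i = g j \<longleftrightarrow> [i = j] (mod n))"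

text \<open>
The periods of \<open>x\<close> are the multiples of some \<open>e\<close>, so exactly \<open>e\<close> values occur; the orbit of \<open>x\<close>
has \<open>n\<close> elements, hence \<open>e = n\<close>.
\<close>

lemma n_cycles_numbering:
  assumes "\<nu> \<in> n_cycles n" "x \<in> {1..n}"
  shows "cyclic_numbering n (\<lambda>i. (\<nu> ^^ i) x)"
proof -
  have perm: "\<nu> permutes {1..n}" and orb: "orbit \<nu> x = {1..n}"
    using assms by (auto simp: n_cycles_def cyclic_on_alldef)
  have inj: "inj (\<nu> ^^ i)" for i
    using perm by (simp add: permutes_inj inj_fn)
  have split: "(\<nu> ^^ (a + b)) x = (\<nu> ^^ a) x \<longleftrightarrow> (\<nu> ^^ b) x = x" for a b
    using inj[of a] by (auto simp: funpow_add inj_eq)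
  obtain p where p: "p > 0" "(\<nu> ^^ p) x = x"
  proof -
    have "x \<in> orbit \<nu> x" using assms(2) orb by simp
    then show ?thesis using that unfolding orbit_altdef by auto
  qed
  obtain e where "e > 0" and e: "\<And>j. (\<nu> ^^ j) x = x \<longleftrightarrow> e dvd j"
    using periods_are_multiples[of "\<lambda>j. (\<nu> ^^ j) x = x" p] p split by metis
  have le: "(\<nu> ^^ i) x = (\<nu> ^^ j) x \<longleftrightarrow> [i = j] (mod e)" if "i \<le> j" for i j
    using that split[of i "j - i"] e[of "j - i"] cong_altdef_nat[of i j e]
    by (auto simp: cong_sym_eq[of i j])
  have iff: "(\<nu> ^^ i) x = (\<nu> ^^ j) x \<longleftrightarrow> [i = j] (mod e)" for i j
    using le[of i j] le[of j i] by (metis cong_sym nat_le_linear)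
  have range: "range (\<lambda>i. (\<nu> ^^ i) x) = {1..n}"
    using orbit_altdef_self_in[of x \<nu>] assms(2) unfolding orb by auto
  have "(\<lambda>i. (\<nu> ^^ i) x) ` {..<e} = range (\<lambda>i. (\<nu> ^^ i) x)"
  proof (intro equalityI subsetI, goal_cases)
    case (2 y)
    then obtain i where "y = (\<nu> ^^ i) x" by auto
    then have "y = (\<nu> ^^ (i mod e)) x" using iff by (auto simp: cong_def)
    then show ?case using \<open>e > 0\<close> by auto
  qed auto
  moreover have "inj_on (\<lambda>i. (\<nu> ^^ i) x) {..<e}"
    using iff by (auto simp: inj_on_def cong_def)
  ultimately have "e = n" using range card_image by fastforce
  then show ?thesis using range iff by (simp add: cyclic_numbering_def)
qed

lemma n_cycle_of_numbering:
  assumes "n > 0" and g: "cyclic_numbering n g"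
  obtains \<nu> where "\<nu> \<in> n_cycles n" "\<And>i. \<nu> (g i) = g (Suc i)"
proof -
  have iff: "g i = g j \<longleftrightarrow> [i = j] (mod n)" and ran: "range g = {1..n}" for i j
    using g by (auto simp: cyclic_numbering_def)
  \<comment> \<open>The index chosen for \<open>y\<close> does not matter, since successors of congruent indices are congruent.\<close>
  define \<nu> where "\<nu> y = (if y \<in> {1..n} then g (Suc (SOME i. g i = y)) else y)" for y
  have step: "\<nu> (g i) = g (Suc i)" for i
  proof -
    have "g (SOME k. g k = g i) = g i" by (rule someI) simp
    then have "g (Suc (SOME k. g k = g i)) = g (Suc i)"
      by (simp add: iff) (metis cong_add_rcancel_nat Suc_eq_plus1)
    moreover have "g i \<in> {1..n}" using ran by blast
    ultimately show ?thesis by (simp add: \<nu>_def)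
  qed
  have pow: "(\<nu> ^^ k) (g i) = g (i + k)" for i k
    by (induction k) (auto simp: step)
  have wrap: "g (i + n) = g i" for i by (simp add: iff cong_def)
  have surj: "\<nu> ` {1..n} = {1..n}"
  proof (intro equalityI subsetI, goal_cases)
    case (1 y)
    then show ?case using ran step by auto (metis atLeastAtMost_iff rangeE rangeI One_nat_def)+
  next
    case (2 y)
    then obtain i where "y = g i" using ran by (metis rangeE)
    then have "y = \<nu> (g (i + (n - 1)))" using wrap[of i] assms(1) by (simp add: step)
    then show ?case using ran by blast
  qed
  then have "inj_on \<nu> {1..n}" by (simp add: eq_card_imp_inj_on)
  then have perm: "\<nu> permutes {1..n}"
    using surj by (intro bij_imp_permutes) (auto simp: bij_betw_def \<nu>_def)
  moreover have "orbit \<nu> (g 0) = {1..n}"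
  proof (intro equalityI subsetI, goal_cases)
    case (1 y)
    then show ?case using ran pow[of _ 0] by (auto simp: orbit_altdef)
  next
    case (2 y)
    then obtain i where "y = g i" using ran by (metis rangeE)
    then have "y = (\<nu> ^^ (i + n)) (g 0)" using wrap pow[of "i + n" 0] by simp
    then show ?case using assms(1) by (auto simp: orbit_altdef)
  qed
  then have "cyclic_on \<nu> {1..n}" using ran unfolding cyclic_on_def by (metis rangeI)
  ultimately show thesis using that step by (auto simp: n_cycles_def)
qed

section \<open>Congruences modulo a product\<close>

text \<open>
An index below \<open>n = d * t\<close> is treated as a position \<open>i mod d\<close> inside a block of length \<open>d\<close>
together with a block number \<open>i div d\<close>, which matters only modulo \<open>t\<close>.
\<close>

lemma cong_mult_modulus_iff:
  fixes i j d t :: nat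
  assumes "d > 0"
  shows "[i = j] (mod d * t) \<longleftrightarrow> i mod d = j mod d \<and> [i div d = j div d] (mod t)"
proof
  assume *: "[i = j] (mod d * t)"
  then have "[i = j] (mod d)" by (rule cong_modulus_mult_nat)
  moreover from this have "d * (i div d mod t) = d * (j div d mod t)"
    using * by (simp add: cong_def mod_mult2_eq)
  ultimately show "i mod d = j mod d \<and> [i div d = j div d] (mod t)"
    using assms by (simp add: cong_def)
qed (simp add: cong_def mod_mult2_eq)

lemma cong_mult_lcancel_modulus:
  fixes a b d t :: nat
  assumes "d > 0"
  shows "[d * a = d * b] (mod d * t) \<longleftrightarrow> [a = b] (mod t)"
  using cong_mult_modulus_iff[OF assms, of "d * a" "d * b" t] assms by simp

section \<open>Powers of the rotation\<close>

text \<open>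
In the coordinate \<open>z = y - 1\<close> the rotation is addition of \<open>1\<close> modulo \<open>n\<close>.
\<close>

lemma rho_pow:
  assumes "z < n"
  shows "(rho n ^^ j) (Suc z) = Suc ((z + j) mod n)"
proof (induction j)
  case 0
  then show ?case using assms by simp
next
  case (Suc j)
  have "n > 0" using assms by simp
  then have "Suc ((z + j) mod n) \<in> {1..n}" by (simp add: Suc_leI)
  then show ?case using Suc by (simp add: rho_def mod_Suc_eq)
qed

lemma in_1_n_obtain_Suc:
  assumes "y \<in> {1..n::nat}"
  obtains z where "y = Suc z" "z < n"
  using assms that[of "y - 1"] by auto

lemma rho_pow_outside: "y \<notin> {1..n} \<Longrightarrow> (rho n ^^ j) y = y"
  by (induction j) (auto simp: rho_def)

lemma rho_pow_in: "y \<in> {1..n} \<Longrightarrow> (rho n ^^ j) y \<in> {1..n}"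
  by (elim in_1_n_obtain_Suc) (simp add: rho_pow Suc_leI)

lemma rho_pow_eq_iff:
  "y \<in> {1..n} \<Longrightarrow> (rho n ^^ i) y = (rho n ^^ j) y \<longleftrightarrow> [i = j] (mod n)"
  by (elim in_1_n_obtain_Suc) (simp add: rho_pow cong_add_lcancel_nat flip: cong_def)

lemma rho_pow_cong_add:
  "y \<in> {1..n} \<Longrightarrow> [(rho n ^^ j) y = y + j] (mod n)"
  by (elim in_1_n_obtain_Suc) (simp add: rho_pow cong_def mod_Suc_eq)

lemma inj_rho_pow: "inj (rho n ^^ j)"
proof (rule injI)
  fix y y' assume eq: "(rho n ^^ j) y = (rho n ^^ j) y'"
  show "y = y'"
  proof (cases "y \<in> {1..n} \<and> y' \<in> {1..n}")
    case True
    then obtain z z' where z: "y = Suc z" "z < n" "y' = Suc z'" "z' < n"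
      by (metis in_1_n_obtain_Suc)
    then have "[z = z'] (mod n)"
      using eq by (simp add: rho_pow cong_add_rcancel_nat flip: cong_def)
    then show ?thesis using z by (simp add: cong_def)
  next
    case False
    then show ?thesis using eq rho_pow_in rho_pow_outside by metis
  qed
qed

lemma bij_rho_pow: "bij (rho n ^^ j)"
proof -
  have inj: "inj_on (rho n) {1..n}"
    using inj_rho_pow[of 1 n] by (simp add: inj_on_def inj_def)
  moreover have "rho n ` {1..n} \<subseteq> {1..n}" using rho_pow_in[of _ n 1] by auto
  ultimately have "rho n ` {1..n} = {1..n}" by (intro endo_inj_surj) auto
  with inj have "rho n permutes {1..n}"
    by (intro bij_imp_permutes) (auto simp: rho_def bij_betw_def)
  then show ?thesis by (simp add: bij_fn permutes_bij)
qed

lemma rho_pow_eq_fun_iff: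
  assumes "n > 0" shows "rho n ^^ i = rho n ^^ j \<longleftrightarrow> [i = j] (mod n)"
proof
  assume "rho n ^^ i = rho n ^^ j"
  then show "[i = j] (mod n)" using rho_pow_eq_iff[of 1 n i j] assms by simp
next
  assume "[i = j] (mod n)"
  then show "rho n ^^ i = rho n ^^ j"
    using rho_pow_eq_iff rho_pow_outside by (intro ext) metis
qed

lemma rho_pow_reaches:
  assumes "y \<in> {1..n}" "z \<in> {1..n}" "d dvd n" "[y = z] (mod d)"
  obtains q where "z = (rho n ^^ (d * q)) y"
proof -
  \<comment> \<open>Adding \<open>n\<close> keeps the difference \<open>z - y\<close> from being truncated.\<close>
  define k where "k = n + z - y"
  have "y + k = n + z" using assms(1) by (simp add: k_def)
  have "d dvd k"
  proof -
    have "[y + k = y + 0] (mod d)"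
      using assms(3,4) \<open>y + k = n + z\<close>
      by (metis add.commute add.right_neutral cong_0_iff cong_add cong_sym)
    then show ?thesis by (simp only: cong_add_lcancel_nat cong_0_iff)
  qed
  moreover have "(rho n ^^ k) y = z"
  proof -
    obtain a b where "y = Suc a" "a < n" "z = Suc b" "b < n"
      using assms(1,2) by (metis in_1_n_obtain_Suc)
    then show ?thesis using \<open>y + k = n + z\<close> by (simp add: rho_pow)
  qed
  ultimately show thesis using that by (auto elim!: dvdE)
qed

section \<open>The symmetry order\<close>

text \<open>
The exponents \<open>j\<close> for which \<open>rho n ^^ j\<close> commutes with \<open>\<nu>\<close> are the multiples of some divisor
\<open>e\<close> of \<open>n\<close>, and the stabilizer therefore has \<open>c = n div e\<close> elements. That \<open>t\<close> divides \<open>c\<close> says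
that \<open>e\<close> divides \<open>n div t\<close>, i.e. that the subgroup of order \<open>t\<close> fixes \<open>\<nu>\<close>.
\<close>

lemma sym_order_dvd:
  assumes "n > 0"
  shows "sym_order n \<nu> dvd n"
    and "t dvd n \<Longrightarrow> t dvd sym_order n \<nu> \<longleftrightarrow>
      rho n ^^ (n div t) \<circ> \<nu> = \<nu> \<circ> rho n ^^ (n div t)"
proof -
  define P where "P j \<longleftrightarrow> rho n ^^ j \<circ> \<nu> = \<nu> \<circ> rho n ^^ j" for j
  have "P n"
    using rho_pow_eq_fun_iff[OF assms, of n 0] by (auto simp: P_def cong_def)
  moreover have "P (a + b)" if "P a" "P b" for a b
    using that by (simp add: P_def funpow_add fun_eq_iff)
  moreover have "P b" if "P (a + b)" "P a" for a b
  proof -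
    have "(rho n ^^ a) ((rho n ^^ b) (\<nu> x)) = (rho n ^^ a) (\<nu> ((rho n ^^ b) x))" for x
      using that by (simp add: P_def funpow_add fun_eq_iff)
    then show ?thesis by (simp add: P_def fun_eq_iff inj_rho_pow inj_eq)
  qed
  ultimately obtain e where "e > 0" and e: "\<And>j. P j \<longleftrightarrow> e dvd j"
    using periods_are_multiples[of P n] assms by metis
  have "e dvd n" using e \<open>P n\<close> by simp
  then obtain c where c: "n = e * c" by blast
  then have "c > 0" using assms by simp
  have conjugate: "rho n ^^ j \<circ> \<nu> \<circ> inv (rho n ^^ j) = \<nu> \<longleftrightarrow> P j" for j
  proof -
    have inv: "inv (rho n ^^ j) ((rho n ^^ j) y) = y" "(rho n ^^ j) (inv (rho n ^^ j) y) = y" for y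
      using bij_rho_pow[of j n] by (simp_all add: bij_is_inj bij_is_surj surj_f_inv_f)
    show ?thesis unfolding P_def fun_eq_iff o_apply using inv by metis
  qed
  have eq_iff: "rho n ^^ (e * i) = rho n ^^ (e * j) \<longleftrightarrow> [i = j] (mod c)" for i j
    unfolding rho_pow_eq_fun_iff[OF assms] unfolding c
    by (rule cong_mult_lcancel_modulus[OF \<open>e > 0\<close>])
  have "rho_stabilizer n \<nu> = (\<lambda>i. rho n ^^ (e * i)) ` {..<c}"
  proof (intro equalityI subsetI, goal_cases)
    case (1 f)
    then obtain j where "f = rho n ^^ j" "P j" by (auto simp: rho_stabilizer_def conjugate)
    then obtain i where "f = rho n ^^ (e * i)" using e[of j] by (auto elim: dvdE)
    moreover have "rho n ^^ (e * i) = rho n ^^ (e * (i mod c))"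
      by (simp add: eq_iff)
    ultimately show ?case using \<open>c > 0\<close> by auto
  next
    case (2 f)
    then show ?case using e by (auto simp: rho_stabilizer_def conjugate)
  qed
  moreover have "inj_on (\<lambda>i. rho n ^^ (e * i)) {..<c}"
    by (auto simp: inj_on_def eq_iff cong_def)
  ultimately have sym: "sym_order n \<nu> = c" by (simp add: sym_order_def card_image)
  show "sym_order n \<nu> dvd n" using sym c by simp
  assume "t dvd n"
  then obtain b where b: "n = t * b" by blast
  then have "t > 0" using assms by simp
  have "t dvd c \<longleftrightarrow> e * t dvd e * c" using \<open>e > 0\<close> by simp
  also have "e * c = t * b" using b c by simp
  also have "e * t dvd t * b \<longleftrightarrow> e dvd b" using \<open>t > 0\<close> by (simp add: mult.commute)
  finally have "t dvd c \<longleftrightarrow> e dvd b" .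
  then show "t dvd sym_order n \<nu> \<longleftrightarrow> rho n ^^ (n div t) \<circ> \<nu> = \<nu> \<circ> rho n ^^ (n div t)"
    using sym b \<open>t > 0\<close> e[of b] by (simp add: P_def)
qed

section \<open>Cycles that commute with a power of the rotation\<close>

text \<open>
For \<open>d\<close> dividing \<open>n\<close>, the residue classes modulo \<open>d\<close> in \<open>{1..n}\<close> are the orbits of
\<open>rho n ^^ d\<close>, so these lists enumerate one representative of each orbit, in an arbitrary order.
\<close>

definition transversals :: "nat \<Rightarrow> nat \<Rightarrow> nat list set" where
  "transversals n d =
     {xs. length xs = d \<and> set xs \<subseteq> {1..n} \<and> distinct (map (\<lambda>x. x mod d) xs)}"

text \<open>
The sequence that starts with the entries of \<open>xs\<close> and in which every block of \<open>d\<close> terms is the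
previous block moved by \<open>rho n ^^ (d * v)\<close>. It is the general shape of \<open>x, \<nu> x, \<nu> (\<nu> x), \<dots>\<close>
for an \<open>n\<close>-cycle \<open>\<nu>\<close> that commutes with \<open>rho n ^^ d\<close>: such a \<open>\<nu>\<close> satisfies
\<open>\<nu> ^^ d = rho n ^^ (d * v)\<close> for some \<open>v\<close> coprime to \<open>n div d\<close>.
\<close>

definition spread :: "nat \<Rightarrow> nat \<Rightarrow> nat \<Rightarrow> nat list \<Rightarrow> nat \<Rightarrow> nat" where
  "spread n d v xs i = (rho n ^^ (d * v * (i div d))) (xs ! (i mod d))"

lemma spread_in:
  assumes "xs \<in> transversals n d" "d > 0"
  shows "xs ! (i mod d) \<in> {1..n}" "spread n d v xs i \<in> {1..n}"
proof -
  show "xs ! (i mod d) \<in> {1..n}"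
    using assms nth_mem[of "i mod d" xs] by (auto simp: transversals_def simp del: nth_mem)
  then show "spread n d v xs i \<in> {1..n}"
    unfolding spread_def by (rule rho_pow_in)
qed

lemma spread_add:
  assumes "d > 0"
  shows "spread n d v xs (i + d * q) = (rho n ^^ (d * v * q)) (spread n d v xs i)"
proof -
  have "d * v * ((i + d * q) div d) = d * v * q + d * v * (i div d)"
    using assms by (simp add: distrib_left)
  then show ?thesis by (simp add: spread_def funpow_add del: mult.assoc)
qed

text \<open>
Equal terms are congruent modulo \<open>d\<close>, so they come from the same entry of \<open>xs\<close>. On a fixed entry,
the blocks number \<open>0, \<dots>, t - 1\<close> act by the rotations by \<open>d * v * q\<close>, which are distinct because
\<open>v\<close> is invertible modulo \<open>t\<close>.
\<close>

lemma spread_numbering: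
  assumes n: "n = d * t" "n > 0" and v: "v \<in> totatives t" and xs: "xs \<in> transversals n d"
  shows "cyclic_numbering n (spread n d v xs)"
proof -
  have "d > 0" using n by simp
  have "coprime v t" using v by (simp add: in_totatives_iff)
  have res: "[spread n d v xs i = xs ! (i mod d)] (mod d)" for i
  proof -
    have "[spread n d v xs i = xs ! (i mod d) + d * v * (i div d)] (mod d * t)"
      unfolding spread_def n(1)[symmetric]
      by (rule rho_pow_cong_add[OF spread_in(1)[OF xs \<open>d > 0\<close>]])
    then have "[spread n d v xs i = xs ! (i mod d) + d * v * (i div d)] (mod d)"
      by (rule cong_modulus_mult_nat)
    then show ?thesis by (simp add: cong_def mult.assoc)
  qed
  have iff: "spread n d v xs i = spread n d v xs j \<longleftrightarrow> [i = j] (mod n)" for i j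
  proof -
    have "i mod d = j mod d" if "spread n d v xs i = spread n d v xs j"
    proof -
      have "xs ! (i mod d) mod d = xs ! (j mod d) mod d"
        using res[of i] res[of j] that by (simp add: cong_def)
      moreover have "i mod d < length xs" "j mod d < length xs" "distinct (map (\<lambda>x. x mod d) xs)"
        using xs \<open>d > 0\<close> by (auto simp: transversals_def)
      ultimately show ?thesis by (metis length_map nth_eq_iff_index_eq nth_map)
    qed
    moreover have "spread n d v xs i = spread n d v xs j \<longleftrightarrow> [i div d = j div d] (mod t)"
      if "i mod d = j mod d"
    proof -
      have "spread n d v xs i = spread n d v xs j \<longleftrightarrow>
          [d * (v * (i div d)) = d * (v * (j div d))] (mod d * t)"
        using that rho_pow_eq_iff[OF spread_in(1)[OF xs \<open>d > 0\<close>, of j]] n(1)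
        by (simp add: spread_def mult.assoc)
      also have "\<dots> \<longleftrightarrow> [i div d = j div d] (mod t)"
        using cong_mult_lcancel_modulus[OF \<open>d > 0\<close>] cong_mult_lcancel_nat[OF \<open>coprime v t\<close>]
        by simp
      finally show ?thesis .
    qed
    ultimately show ?thesis
      unfolding n(1) cong_mult_modulus_iff[OF \<open>d > 0\<close>] by blast
  qed
  have "inj_on (spread n d v xs) {..<n}"
    by (auto simp: inj_on_def iff cong_def)
  then have "spread n d v xs ` {..<n} = {1..n}"
    using spread_in(2)[OF xs \<open>d > 0\<close>]
    by (intro card_subset_eq) (auto simp: card_image simp del: atLeastAtMost_iff)
  then have "range (spread n d v xs) = {1..n}"
    using spread_in(2)[OF xs \<open>d > 0\<close>] by blast
  then show ?thesis using iff by (simp add: cyclic_numbering_def)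
qed

text \<open>
The representative of the inverse is taken in \<open>{1..t}\<close> to fit the convention for
\<^const>\<open>totatives\<close>; for \<open>t = 1\<close> this is \<open>1\<close> rather than the remainder \<open>0\<close>.
\<close>

lemma totative_inverse:
  assumes "coprime v t" "t > 0"
  obtains w where "w \<in> totatives t" "[v * w = 1] (mod t)"
proof -
  obtain w where w: "[v * w = 1] (mod t)"
    using assms cong_solve_coprime_nat by (metis One_nat_def)
  define w' where "w' = (if t = 1 then 1 else w mod t)"
  have w': "[v * w' = 1] (mod t)"
    using w by (auto simp: w'_def cong_def mod_mult_right_eq)
  then have "coprime w' t"
    by (metis coprime_iff_invertible_nat mult.commute One_nat_def)
  moreover have "w' > 0"
    using \<open>coprime w' t\<close> by (cases "w' = 0") (auto simp: w'_def)
  moreover have "w' \<le> t"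
    using assms(2) by (simp add: w'_def less_imp_le)
  ultimately show thesis using w' that by (simp add: in_totatives_iff)
qed

text \<open>
With \<open>w\<close> inverse to \<open>v\<close> modulo \<open>t\<close>, the rotation by \<open>d\<close> is the rotation by \<open>d * v * w\<close>, hence on
the sequence it is a shift of the index by \<open>d * w\<close>, and shifts of the index commute with the successor.
\<close>

lemma spread_successor_commutes:
  assumes n: "n = d * t" "n > 0" and v: "v \<in> totatives t" and xs: "xs \<in> transversals n d"
    and \<nu>: "\<nu> \<in> n_cycles n" "\<And>i. \<nu> (spread n d v xs i) = spread n d v xs (Suc i)"
  shows "rho n ^^ d \<circ> \<nu> = \<nu> \<circ> rho n ^^ d"
proof
  fix y
  have "d > 0" "t > 0" using n by auto
  obtain w where w: "[v * w = 1] (mod t)"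
    using totative_inverse[of v t] v \<open>t > 0\<close> by (auto simp: in_totatives_iff)
  have rot: "(rho n ^^ d) (spread n d v xs i) = spread n d v xs (i + d * w)" for i
  proof -
    have "[d * (v * w) = d * 1] (mod n)"
      unfolding n(1) cong_mult_lcancel_modulus[OF \<open>d > 0\<close>] by (rule w)
    then show ?thesis
      unfolding spread_add[OF \<open>d > 0\<close>]
      using rho_pow_eq_iff[OF spread_in(2)[OF xs \<open>d > 0\<close>]]
      by (simp add: mult.assoc cong_sym_eq[of d])
  qed
  show "(rho n ^^ d \<circ> \<nu>) y = (\<nu> \<circ> rho n ^^ d) y"
  proof (cases "y \<in> {1..n}")
    case True
    then obtain i where "y = spread n d v xs i"
      using spread_numbering[OF n v xs] unfolding cyclic_numbering_def by (metis rangeE)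
    then show ?thesis by (simp add: rot \<nu>)
  next
    case False
    then show ?thesis
      using \<nu>(1) permutes_not_in[of \<nu> "{1..n}" y]
      by (simp add: rho_pow_outside n_cycles_def del: atLeastAtMost_iff)
  qed
qed

text \<open>
Along the orbit \<open>g\<close> of \<open>x\<close>, the rotation by \<open>d\<close> shifts the index by a constant \<open>k\<close>, because it
commutes with \<open>\<nu>\<close>. Both this shift and the rotation have order \<open>t\<close>, which forces \<open>k = d * u\<close> with
\<open>u\<close> coprime to \<open>t\<close>. Inverting \<open>u\<close> modulo \<open>t\<close> expresses the shift by \<open>d\<close> as a rotation, so the
first \<open>d\<close> terms determine the rest.
\<close>

lemma commuting_cycle_is_spread:
  assumes n: "n = d * t" "n > 0" and \<nu>: "\<nu> \<in> n_cycles n" and x: "x \<in> {1..n}"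
    and comm: "rho n ^^ d \<circ> \<nu> = \<nu> \<circ> rho n ^^ d"
  obtains v xs where "v \<in> totatives t" "xs \<in> transversals n d"
    "(\<lambda>i. (\<nu> ^^ i) x) = spread n d v xs"
proof -
  have "d > 0" "t > 0" using n by auto
  define g where "g = (\<lambda>i. (\<nu> ^^ i) x)"
  have "cyclic_numbering n g"
    using n_cycles_numbering[OF \<nu> x] unfolding g_def .
  then have iff: "g i = g j \<longleftrightarrow> [i = j] (mod n)" and ran: "range g = {1..n}" for i j
    by (auto simp: cyclic_numbering_def)
  then have g_in: "g i \<in> {1..n}" for i by blast
  have "(rho n ^^ d) (g 0) \<in> {1..n}" by (rule rho_pow_in[OF g_in])
  then obtain k where k: "(rho n ^^ d) (g 0) = g k"
    using ran by (metis rangeE)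
  have rot: "(rho n ^^ d) (g i) = g (i + k)" for i
  proof (induction i)
    case (Suc i)
    have "(rho n ^^ d) (\<nu> (g i)) = \<nu> ((rho n ^^ d) (g i))"
      using comm by (simp add: fun_eq_iff)
    then show ?case using Suc by (simp add: g_def)
  qed (simp add: k)
  have rots: "(rho n ^^ (d * q)) (g i) = g (i + k * q)" for i q
    by (induction q) (simp_all add: funpow_add rot add_ac)
  \<comment> \<open>The shift by \<open>k\<close> has order \<open>t\<close>, like the rotation by \<open>d\<close>.\<close>
  have per: "n dvd k * q \<longleftrightarrow> t dvd q" for q
  proof -
    have "n dvd k * q \<longleftrightarrow> g (0 + k * q) = g 0"
      by (simp add: iff cong_0_iff)
    also have "\<dots> \<longleftrightarrow> (rho n ^^ (d * q)) (g 0) = (rho n ^^ 0) (g 0)"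
      by (simp only: rots[of q 0]) simp
    also have "\<dots> \<longleftrightarrow> n dvd d * q"
      unfolding rho_pow_eq_iff[OF g_in] by (simp add: cong_0_iff)
    finally show ?thesis using \<open>d > 0\<close> by (simp add: n(1))
  qed
  then have "n dvd k * t" by simp
  then obtain u where u: "k = d * u"
    using \<open>t > 0\<close> by (auto simp: n(1))
  have dvd_u: "t dvd u * q \<longleftrightarrow> t dvd q" for q
    using per[of q] \<open>d > 0\<close> by (simp add: n(1) u mult.assoc)
  have "coprime u t"
  proof -
    \<comment> \<open>If \<open>c = gcd u t\<close>, then already the multiple \<open>t div c\<close> of \<open>u\<close> is divisible by \<open>t\<close>.\<close>
    define c where "c = gcd u t"
    obtain a b where ab: "u = c * a" "t = c * b"
      unfolding c_def by (meson dvdE gcd_dvd1 gcd_dvd2)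
    have "b > 0" using ab(2) \<open>t > 0\<close> by simp
    have "t dvd u * b" using ab by simp
    then have "t dvd b" using dvd_u by simp
    then have "c = 1" using ab(2) \<open>b > 0\<close> by (simp add: dvd_def)
    then show ?thesis by (simp add: c_def coprime_iff_gcd_eq_1)
  qed
  then obtain v where v: "v \<in> totatives t" "[u * v = 1] (mod t)"
    using totative_inverse \<open>t > 0\<close> by metis
  have step: "(rho n ^^ (d * v * q)) (g i) = g (i + d * q)" for i q
  proof -
    have "[d * (u * v * q) = d * (1 * q)] (mod n)"
      unfolding n(1) cong_mult_lcancel_modulus[OF \<open>d > 0\<close>] by (intro cong_scalar_right v(2))
    then have "[i + k * (v * q) = i + d * q] (mod n)"
      by (simp add: u mult.assoc cong_add_lcancel_nat)
    then show ?thesis using rots[of "v * q" i] by (simp add: iff mult.assoc)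
  qed
  define xs where "xs = map g [0..<d]"
  \<comment> \<open>Terms in the same orbit of the rotation by \<open>d\<close> differ by a shift by a multiple of \<open>k\<close>, hence of \<open>d\<close>.\<close>
  have "inj_on (\<lambda>i. g i mod d) {..<d}"
  proof (rule inj_onI, goal_cases)
    case (1 i j)
    then have "[g i = g j] (mod d)" by (simp add: cong_def)
    then obtain q where "g j = (rho n ^^ (d * q)) (g i)"
      using rho_pow_reaches[OF g_in g_in, of d i j] n(1) by auto
    then have "[j = i + k * q] (mod n)"
      by (simp only: rots iff)
    then have "[j = i + d * (u * q)] (mod d * t)"
      by (simp only: u n(1) mult.assoc)
    then have "[j = i + d * (u * q)] (mod d)" by (rule cong_modulus_mult_nat)
    then show "i = j" using 1 by (simp add: cong_def)
  qed
  then have "distinct (map (\<lambda>x. x mod d) xs)"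
    by (simp only: xs_def map_map distinct_map[of _ "[0..<d]"]) (simp add: comp_def atLeast0LessThan)
  then have "xs \<in> transversals n d"
    using g_in by (auto simp: transversals_def xs_def simp del: atLeastAtMost_iff)
  moreover have "g = spread n d v xs"
  proof
    fix i
    have "g i = g (i mod d + d * (i div d))" by simp
    also have "\<dots> = spread n d v xs i"
      using \<open>d > 0\<close> by (simp only: step[symmetric]) (simp add: spread_def xs_def)
    finally show "g i = spread n d v xs i" .
  qed
  ultimately show thesis using that v(1) unfolding g_def by blast
qed

text \<open>
The first \<open>d\<close> terms are \<open>xs\<close> itself, and the next one is \<open>xs ! 0\<close> rotated by \<open>d * v\<close>, from which
\<open>v\<close> can be read off modulo \<open>t\<close>.
\<close>

lemma spread_inj:
  assumes n: "n = d * t" "n > 0"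
  shows "inj_on (\<lambda>(v, xs). spread n d v xs) (totatives t \<times> transversals n d)"
proof (rule inj_onI, clarify)
  fix v xs v' xs'
  assume v: "v \<in> totatives t" "v' \<in> totatives t"
    and xs: "xs \<in> transversals n d" "xs' \<in> transversals n d"
    and eq: "spread n d v xs = spread n d v' xs'"
  have "d > 0" using n by simp
  have nth: "spread n d w ys i = ys ! i" if "i < d" for w ys i
    using that by (simp add: spread_def)
  have "xs ! i = xs' ! i" if "i < d" for i
    using nth[OF that] eq by metis
  then have "xs = xs'"
    using xs by (intro nth_equalityI) (auto simp: transversals_def)
  have "(rho n ^^ (d * v)) (xs ! 0) = (rho n ^^ (d * v')) (xs ! 0)"
    using fun_cong[OF eq, of d] \<open>d > 0\<close> \<open>xs = xs'\<close> by (simp add: spread_def)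
  moreover have "xs ! 0 \<in> {1..n}"
    using spread_in(1)[OF xs(1) \<open>d > 0\<close>, of 0] by simp
  ultimately have "[d * v = d * v'] (mod d * t)"
    using rho_pow_eq_iff n(1) by metis
  then have "[v = v'] (mod t)"
    by (simp only: cong_mult_lcancel_modulus[OF \<open>d > 0\<close>])
  then have "v = v'"
    using v totatives_less[of v t] totatives_less[of v' t]
    by (cases "t \<le> 1") (auto simp: cong_def in_totatives_iff)
  then show "v = v' \<and> xs = xs'" using \<open>xs = xs'\<close> by simp
qed

text \<open>
The factor \<open>n\<close> counts the starting points: pairs of a commuting cycle and a starting point, and
pairs of a unit modulo \<open>t\<close> and a transversal, are both in bijection with the same set of sequences.
\<close>

lemma card_commuting_cycles_transversals:
  assumes n: "n = d * t" "n > 0"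
  shows "card {\<nu> \<in> n_cycles n. rho n ^^ d \<circ> \<nu> = \<nu> \<circ> rho n ^^ d} * n =
    totient t * card (transversals n d)"
proof -
  define C where "C = {\<nu> \<in> n_cycles n. rho n ^^ d \<circ> \<nu> = \<nu> \<circ> rho n ^^ d}"
  define orb where "orb = (\<lambda>(\<nu> :: nat \<Rightarrow> nat, x :: nat) i. (\<nu> ^^ i) x)"
  have "inj_on orb (C \<times> {1..n})"
  proof (rule inj_onI, clarify)
    fix \<nu> \<nu>' x x'
    assume \<nu>: "\<nu> \<in> C" "\<nu>' \<in> C" and x: "x \<in> {1..n}" "x' \<in> {1..n}"
      and "orb (\<nu>, x) = orb (\<nu>', x')"
    then have eq: "(\<nu> ^^ i) x = (\<nu>' ^^ i) x'" for i
      unfolding orb_def by (simp add: fun_eq_iff)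
    \<comment> \<open>The orbit of one point is all of \<open>{1..n}\<close>, so it determines the cycle.\<close>
    have "\<nu> y = \<nu>' y" for y
    proof (cases "y \<in> {1..n}")
      case True
      then obtain i where "y = (\<nu> ^^ i) x"
        using n_cycles_numbering[of \<nu> n x] \<nu> x unfolding cyclic_numbering_def C_def
        by (metis (no_types, lifting) mem_Collect_eq rangeE)
      then show ?thesis using eq[of i] eq[of "Suc i"] by simp
    next
      case False
      then show ?thesis
        using \<nu> permutes_not_in[of \<nu> "{1..n}" y] permutes_not_in[of \<nu>' "{1..n}" y]
        by (simp add: C_def n_cycles_def del: atLeastAtMost_iff One_nat_def)
    qed
    then show "\<nu> = \<nu>' \<and> x = x'" using eq[of 0] by auto
  qed
  moreover have "orb ` (C \<times> {1..n}) = (\<lambda>(v, xs). spread n d v xs) ` (totatives t \<times> transversals n d)"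
  proof (intro equalityI subsetI, goal_cases)
    case (1 g)
    then obtain \<nu> x where "\<nu> \<in> C" and x: "x \<in> {1..n}" and g: "g = (\<lambda>i. (\<nu> ^^ i) x)"
      by (auto simp: orb_def)
    then have "\<nu> \<in> n_cycles n" "rho n ^^ d \<circ> \<nu> = \<nu> \<circ> rho n ^^ d"
      by (auto simp: C_def)
    then obtain v xs where "v \<in> totatives t" "xs \<in> transversals n d" "g = spread n d v xs"
      using commuting_cycle_is_spread[OF n _ x] g by metis
    then show ?case by blast
  next
    case (2 g)
    then obtain v xs where v: "v \<in> totatives t" "xs \<in> transversals n d" and g: "g = spread n d v xs"
      by auto
    obtain \<nu> where \<nu>: "\<nu> \<in> n_cycles n" "\<And>i. \<nu> (g i) = g (Suc i)"
      using n_cycle_of_numbering[OF n(2) spread_numbering[OF n v]] g by metis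
    then have "\<nu> \<in> C"
      using spread_successor_commutes[OF n v] g by (auto simp: C_def)
    moreover have "g 0 \<in> {1..n}" using spread_in(2)[OF v(2)] n g by simp
    moreover have "(\<nu> ^^ i) (g 0) = g i" for i by (induction i) (simp_all add: \<nu>)
    then have "g = orb (\<nu>, g 0)" by (simp add: orb_def)
    ultimately show ?case by blast
  qed
  ultimately have "card (C \<times> {1..n}) = card (totatives t \<times> transversals n d)"
    using card_image[of orb "C \<times> {1..n}"] card_image[OF spread_inj[OF n]] by argo
  then show ?thesis by (simp add: C_def card_cartesian_product totient_def)
qed

section \<open>Lists with entries in distinct fibres\<close>

text \<open>
The entries are chosen one after the other. Once \<open>k\<close> fibres are taken, the next entry is any
element of the remaining \<open>card (f ` A) - k\<close> fibres, which gives \<open>t * (card (f ` A) - k)\<close> choices.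
Multiplying by the factorial of the number of unused fibres avoids a falling factorial.
\<close>

lemma card_lists_distinct_map:
  assumes "finite A" and fibre: "\<And>b. b \<in> f ` A \<Longrightarrow> card {a \<in> A. f a = b} = t"
    and "k \<le> card (f ` A)"
  shows "card {xs. length xs = k \<and> set xs \<subseteq> A \<and> distinct (map f xs)} * fact (card (f ` A) - k) =
    t ^ k * fact (card (f ` A))"
  using assms(3)
proof (induction k)
  case 0
  have "{xs. length xs = 0 \<and> set xs \<subseteq> A \<and> distinct (map f xs)} = {[]}" by auto
  then show ?case by simp
next
  case (Suc k)
  define L where "L k = {xs. length xs = k \<and> set xs \<subseteq> A \<and> distinct (map f xs)}" for k
  have fin: "finite (L k)"
    using finite_lists_length_eq[OF assms(1), of k] by (rule rev_finite_subset) (auto simp: L_def)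
  have "L (Suc k) = (\<lambda>(xs, y). y # xs) ` (SIGMA xs : L k. {a \<in> A. f a \<in> f ` A - f ` set xs})"
    by (auto simp: L_def length_Suc_conv image_iff)
  moreover have "inj_on (\<lambda>(xs, y). y # xs) (SIGMA xs : L k. {a \<in> A. f a \<in> f ` A - f ` set xs})"
    by (auto simp: inj_on_def)
  ultimately have "card (L (Suc k)) = card (SIGMA xs : L k. {a \<in> A. f a \<in> f ` A - f ` set xs})"
    by (simp add: card_image)
  also have "\<dots> = (\<Sum>xs\<in>L k. card {a \<in> A. f a \<in> f ` A - f ` set xs})"
    using fin assms(1) by simp
  also have "\<dots> = (\<Sum>xs\<in>L k. t * (card (f ` A) - k))"
  proof (rule sum.cong[OF refl])
    fix xs assume xs: "xs \<in> L k"
    let ?B = "f ` A - f ` set xs"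
    have "{a \<in> A. f a \<in> ?B} = (\<Union>b\<in>?B. {a \<in> A. f a = b})"
      by (simp add: set_eq_iff)
    then have "card {a \<in> A. f a \<in> ?B} = (\<Sum>b\<in>?B. card {a \<in> A. f a = b})"
      using assms(1) by (simp only:) (rule card_UN_disjoint; fastforce)
    also have "\<dots> = t * card ?B" using fibre by simp
    also have "card ?B = card (f ` A) - card (f ` set xs)"
      using xs by (intro card_Diff_subset) (auto simp: L_def)
    also have "card (f ` set xs) = k"
      using xs distinct_card[of "map f xs"] by (simp add: L_def)
    finally show "card {a \<in> A. f a \<in> ?B} = t * (card (f ` A) - k)" .
  qed
  finally have "card (L (Suc k)) = card (L k) * (t * (card (f ` A) - k))" by simp
  moreover have "fact (card (f ` A) - k) = (card (f ` A) - k) * fact (card (f ` A) - Suc k)"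
    using Suc.prems by (simp add: fact_reduce)
  ultimately show ?case using Suc by (simp add: L_def mult_ac)
qed

lemma card_transversals:
  assumes n: "n = d * t" "n > 0"
  shows "card (transversals n d) = t ^ d * fact d"
proof -
  have "d > 0" using n by simp
  let ?f = "\<lambda>x. x mod d"
  have fibre: "card {a \<in> {1..n}. a mod d = b} = t" if "b < d" for b
  proof -
    \<comment> \<open>The representative of the class of \<open>b\<close> in \<open>{1..d}\<close>, matching the convention for \<open>{1..n}\<close>.\<close>
    define r where "r = (if b = 0 then d else b)"
    have r: "r \<in> {1..d}" "r mod d = b" using that \<open>d > 0\<close> by (auto simp: r_def)
    have r_unique: "c = r" if "c \<in> {1..d}" "c mod d = b" for c
      using that \<open>b < d\<close> by (cases "c = d") (auto simp: r_def)
    have "bij_betw (\<lambda>q. d * q + r) {..<t} {a \<in> {1..n}. a mod d = b}"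
    proof (rule bij_betwI')
      fix q assume "q \<in> {..<t}"
      then have "d * Suc q \<le> n" unfolding n(1) by (intro mult_le_mono2) auto
      then show "d * q + r \<in> {a \<in> {1..n}. a mod d = b}" using r by auto
    next
      fix a assume a: "a \<in> {a \<in> {1..n}. a mod d = b}"
      then obtain z where z: "a = Suc z" "z < n" using in_1_n_obtain_Suc[of a n] by auto
      have "a = d * (z div d) + Suc (z mod d)" using z by simp
      moreover have "Suc (z mod d) = r"
        using a z \<open>d > 0\<close> by (intro r_unique) (auto simp: mod_Suc_eq Suc_leI)
      moreover have "z div d < t" using z n by (simp add: less_mult_imp_div_less mult.commute)
      ultimately show "\<exists>q\<in>{..<t}. a = d * q + r" by auto
    qed (use \<open>d > 0\<close> in auto)
    then show ?thesis using bij_betw_same_card by fastforce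
  qed
  have "t > 0" using n by simp
  have img: "?f ` {1..n} = {..<d}"
  proof (intro equalityI subsetI)
    fix b assume "b \<in> {..<d}"
    then have "{a \<in> {1..n}. a mod d = b} \<noteq> {}"
      using fibre[of b] \<open>t > 0\<close> by (metis card.empty lessThan_iff less_irrefl)
    then show "b \<in> ?f ` {1..n}" by auto
  qed (use \<open>d > 0\<close> in auto)
  show ?thesis
    using card_lists_distinct_map[of "{1..n}" ?f t d] fibre img by (simp add: transversals_def)
qed

lemma card_cycles_sym_multiple:
  assumes "t dvd n" "n > 0"
  shows "card {\<nu> \<in> n_cycles n. t dvd sym_order n \<nu>} * n =
    totient t * (t ^ (n div t) * fact (n div t))"
proof -
  have "n = (n div t) * t" using assms(1) by simp
  then show ?thesis
    using card_commuting_cycles_transversals[of n "n div t" t] card_transversals[of n "n div t" t]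
      sym_order_dvd(2)[OF assms(2,1)] assms(2)
    by simp
qed

section \<open>Moebius inversion\<close>

lemma moebius_mu_prime_mult:
  assumes "prime p" "\<not> p dvd j"
  shows "moebius_mu (p * j) = - moebius_mu j"
proof -
  have "coprime p j" using assms by (simp add: prime_imp_coprime)
  have "j \<noteq> 0" using assms(2) by (intro notI) simp
  have "squarefree (p * j) \<longleftrightarrow> squarefree j"
    using squarefree_mult_coprime[OF \<open>coprime p j\<close>] squarefree_prime[OF assms(1)]
      squarefree_multD(2) by blast
  moreover have "prime_factors (p * j) = insert p (prime_factors j)"
    using assms(1) \<open>j \<noteq> 0\<close> by (simp add: prime_factors_product prime_prime_factors)
  moreover have "p \<notin> prime_factors j" using assms(2) by auto
  ultimately show ?thesis by (simp add: moebius_mu_def)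
qed

text \<open>
Fix a prime \<open>p\<close> dividing \<open>m\<close>. A divisor contributes only if \<open>p\<close> divides it at most once, and the
divisors \<open>j\<close> prime to \<open>p\<close> cancel against the divisors \<open>p * j\<close>.
\<close>

lemma sum_moebius_mu_divisors:
  assumes "m > 0"
  shows "(\<Sum>j | j dvd m. moebius_mu j) = (if m = 1 then 1 else 0)"
proof (cases "m = 1")
  case True
  then show ?thesis by (simp add: moebius_mu_def)
next
  case False
  then obtain p where p: "prime p" "p dvd m" using prime_factor_nat by blast
  define A where "A = {j. j dvd m \<and> \<not> p dvd j}"
  have fin: "finite {j. j dvd m}" using assms by simp
  have "finite A" using fin by (rule rev_finite_subset) (auto simp: A_def)
  have sub: "A \<union> (*) p ` A \<subseteq> {j. j dvd m}"
    using p by (auto simp: A_def intro!: divides_mult prime_imp_coprime)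
  have zero: "moebius_mu j = 0" if "j \<in> {j. j dvd m} - (A \<union> (*) p ` A)" for j
  proof -
    from that have "p dvd j" "j dvd m" by (auto simp: A_def)
    then obtain i where i: "j = p * i" by blast
    have "i dvd m" using i \<open>j dvd m\<close> by (simp add: dvd_mult_right)
    then have "p dvd i" using that i by (auto simp: A_def)
    then have "p ^ 2 dvd j" unfolding i power2_eq_square by (intro mult_dvd_mono) auto
    then have "\<not> squarefree j" using p(1) not_squarefreeI not_prime_unit by blast
    then show ?thesis by (simp add: moebius_mu_def)
  qed
  have "(\<Sum>j | j dvd m. moebius_mu j) = (\<Sum>j\<in>A \<union> (*) p ` A. moebius_mu j)"
    using fin sub zero by (intro sum.mono_neutral_right) auto
  also have "\<dots> = (\<Sum>j\<in>A. moebius_mu j) + (\<Sum>j\<in>(*) p ` A. moebius_mu j)"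
    using \<open>finite A\<close> by (intro sum.union_disjoint) (auto simp: A_def)
  also have "(\<Sum>j\<in>(*) p ` A. moebius_mu j) = (\<Sum>j\<in>A. moebius_mu (p * j))"
    using p(1) by (subst sum.reindex) (auto simp: inj_on_def prime_gt_0_nat)
  also have "\<dots> = (\<Sum>j\<in>A. - moebius_mu j)"
    using p(1) by (intro sum.cong) (auto simp: A_def moebius_mu_prime_mult)
  finally show ?thesis using False by (simp add: sum_negf)
qed

text \<open>
Moebius inversion over the divisor lattice of \<open>n\<close> in counting form. After the sums are exchanged,
an element \<open>x\<close> with \<open>f x = s * m\<close> contributes the sum of the Moebius function over the divisors
of \<open>m\<close>, and an element with \<open>f x\<close> no multiple of \<open>s\<close> contributes nothing.
\<close>

lemma moebius_count:
  fixes f :: "'a \<Rightarrow> nat"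
  assumes "finite X" "n > 0" "s > 0" "s dvd n" and f: "\<And>x. x \<in> X \<Longrightarrow> f x dvd n"
  shows "int (card {x \<in> X. f x = s}) =
    (\<Sum>j | j dvd n div s. moebius_mu j * int (card {x \<in> X. s * j dvd f x}))"
proof -
  define D where "D = {j. j dvd n div s}"
  have "n div s > 0" using assms by (auto elim: dvdE)
  then have "finite D" by (simp add: D_def)
  have inner: "(\<Sum>j\<in>D. if s * j dvd f x then moebius_mu j else 0) = (if f x = s then 1 else 0)"
    if "x \<in> X" for x
  proof (cases "s dvd f x")
    case True
    then obtain m where m: "f x = s * m" by blast
    have "f x > 0" using f[OF that] \<open>n > 0\<close> by (auto intro: Nat.gr0I)
    then have "m > 0" using m by simp
    have "m dvd n div s"
      using f[OF that] assms(3,4) m by (auto elim!: dvdE)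
    then have "{j \<in> D. s * j dvd f x} = {j. j dvd m}"
      using m \<open>s > 0\<close> by (auto simp: D_def intro: dvd_trans)
    then have "(\<Sum>j\<in>D. if s * j dvd f x then moebius_mu j else 0) = (\<Sum>j | j dvd m. moebius_mu j)"
      using \<open>finite D\<close> by (simp flip: sum.inter_filter)
    then show ?thesis using sum_moebius_mu_divisors[OF \<open>m > 0\<close>] m \<open>s > 0\<close> by simp
  next
    case False
    then show ?thesis by (auto intro!: sum.neutral dest: dvd_mult_left)
  qed
  have "(\<Sum>j\<in>D. moebius_mu j * int (card {x \<in> X. s * j dvd f x})) =
      (\<Sum>j\<in>D. \<Sum>x\<in>X. if s * j dvd f x then moebius_mu j else 0)"
    using \<open>finite X\<close> by (simp add: mult.commute flip: sum.inter_filter)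
  also have "\<dots> = (\<Sum>x\<in>X. \<Sum>j\<in>D. if s * j dvd f x then moebius_mu j else 0)"
    by (rule sum.swap)
  also have "\<dots> = (\<Sum>x\<in>X. if f x = s then 1 else 0)"
    using inner by (intro sum.cong) auto
  also have "\<dots> = int (card {x \<in> X. f x = s})"
    using \<open>finite X\<close> by (simp flip: sum.inter_filter)
  finally show ?thesis by (simp add: D_def)
qed

theorem theorem3p1:
  fixes n s :: nat
  assumes "n \<ge> 2" and "s > 0" and "s dvd n"
  shows "real (num_cycles_sym n s) =
    1 / real n * (\<Sum>j | j dvd n div s.
      real_of_int (moebius_mu j) * real (totient (s * j)) *
      real (s * j) ^ (n div (s * j)) * fact (n div (s * j)))"
proof -
  have "n > 0" using assms(1) by simp
  have "finite (n_cycles n)"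
    using finite_permutations[of "{1..n}"] by (rule rev_finite_subset) (auto simp: n_cycles_def)
  then have "int (num_cycles_sym n s) =
    (\<Sum>j | j dvd n div s. moebius_mu j * int (card {\<nu> \<in> n_cycles n. s * j dvd sym_order n \<nu>}))"
    unfolding num_cycles_sym_def
    using moebius_count[of "n_cycles n" n s "sym_order n"] \<open>n > 0\<close> assms sym_order_dvd(1) by blast
  then have "real (num_cycles_sym n s) = (\<Sum>j | j dvd n div s.
      real_of_int (moebius_mu j) * real (card {\<nu> \<in> n_cycles n. s * j dvd sym_order n \<nu>}))"
    by (metis (no_types, lifting) of_int_of_nat_eq of_int_mult of_int_sum sum.cong)
  also have "\<dots> = (\<Sum>j | j dvd n div s. 1 / real n * (
      real_of_int (moebius_mu j) * real (totient (s * j)) *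
      real (s * j) ^ (n div (s * j)) * fact (n div (s * j))))"
  proof (intro sum.cong refl, goal_cases)
    case (1 j)
    then have "s * j dvd s * (n div s)" by (intro mult_dvd_mono) auto
    then have "s * j dvd n" using assms(3) by simp
    then have "real (card {\<nu> \<in> n_cycles n. s * j dvd sym_order n \<nu>} * n) =
      real (totient (s * j) * ((s * j) ^ (n div (s * j)) * fact (n div (s * j))))"
      using card_cycles_sym_multiple[of "s * j" n] \<open>n > 0\<close> by simp
    then have "real (card {\<nu> \<in> n_cycles n. s * j dvd sym_order n \<nu>}) = 1 / real n *
      (real (totient (s * j)) * (real (s * j) ^ (n div (s * j)) * fact (n div (s * j))))"
      using \<open>n > 0\<close> by (simp add: field_simps)
    then show ?case by (simp only: mult_ac)
  qed
  finally show ?thesis by (simp only: sum_distrib_left)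
qed

end
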